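(* Let $T_n$ be a tree on $n$ vertices with bipartition $(X_1,X_2)$, and let $|X_i|=q_i$ for $i=1,2$. Then $mc^{nh}_n(T_n)\geq q$, where $q=\min\{q_1,q_2\}$.
   Context: All graphs are simple and finite. For a graph $G$ with $n$ vertices, a no-hole anti-$n$-labeling of $G$ is a map $\psi:V(G)\to\{1,2,\ldots,n\}$ that uses all labels between $1$ and $n$ (hence a bijection). For an edge $e=uv$ put $w^{nh}_\psi(e)=|\psi(u)-\psi(v)|$, and let $w^{nh}_\psi(G)=\min\{w^{nh}_\psi(e): e\in E(G)\}$. The no-hole anti-$n$-labeling number of $G$ is $mc^{nh}_n(G)=\max_\psi w^{nh}_\psi(G)$, the maximum being over all no-hole anti-$n$-labelings $\psi$ of $G$. *)

theory Defs
  imports "Graph_Theory.Digraph_Component" "HOL-Library.FuncSet"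
begin

text \<open>
  A finite simple graph is a \<^locale>\<open>pair_graph\<close>: a finite loop-free digraph whose arc relation is
  symmetric, so an undirected edge is the pair of arcs (u,v) and (v,u).

  The constant \<^const>\<open>tree\<close> must not be used for such graphs. It forbids every directed cycle, and
  going along an edge and back is a directed cycle of length 2. The cycles of the undirected graph
  are exactly those of length at least 3.
\<close>

definition undirected_tree :: "'a pair_pre_digraph \<Rightarrow> bool" where
  "undirected_tree G \<longleftrightarrow>
     pair_graph G \<and> connected (with_proj G) \<and>
     \<not> (\<exists>p. pre_digraph.cycle (with_proj G) p \<and> 3 \<le> length p)"

text \<open>The parts may be empty, so that the one-vertex tree has a bipartition.\<close>

definition bipartition :: "'a pair_pre_digraph \<Rightarrow> 'a set \<Rightarrow> 'a set \<Rightarrow> bool" where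
  "bipartition G X1 X2 \<longleftrightarrow>
     X1 \<union> X2 = pverts G \<and> X1 \<inter> X2 = {} \<and>
     (\<forall>(u, v) \<in> parcs G. (u \<in> X1 \<and> v \<in> X2) \<or> (u \<in> X2 \<and> v \<in> X1))"

text \<open>The number \<open>n\<close> is meant to be the number of vertices of \<open>G\<close>; otherwise the set of labelings
  may be empty.\<close>

definition no_hole_labelings :: "nat \<Rightarrow> 'a pair_pre_digraph \<Rightarrow> ('a \<Rightarrow> nat) set" where
  "no_hole_labelings n G = {\<psi> \<in> pverts G \<rightarrow>\<^sub>E {1..n}. \<psi> ` pverts G = {1..n}}"

definition edge_weight :: "('a \<Rightarrow> nat) \<Rightarrow> 'a \<times> 'a \<Rightarrow> nat" where
  "edge_weight \<psi> e = nat \<bar>int (\<psi> (fst e)) - int (\<psi> (snd e))\<bar>"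

text \<open>For a graph without edges this is the unspecified number \<^term>\<open>Min {} :: nat\<close>.\<close>

definition labeling_weight :: "'a pair_pre_digraph \<Rightarrow> ('a \<Rightarrow> nat) \<Rightarrow> nat" where
  "labeling_weight G \<psi> = Min (edge_weight \<psi> ` parcs G)"

definition mc_nh :: "nat \<Rightarrow> 'a pair_pre_digraph \<Rightarrow> nat" where
  "mc_nh n G = Max (labeling_weight G ` no_hole_labelings n G)"

end

theory Submission
  imports Defs
begin

text \<open>
  Let \<^term>\<open>X\<close> be the smaller part and \<^term>\<open>Y\<close> the larger one. Give \<^term>\<open>X\<close> the labels
  \<open>1, \<dots>, card X\<close> and \<^term>\<open>Y\<close> the labels above them. If \<^term>\<open>x\<close> is the \<open>i\<close>-th vertex of
  \<^term>\<open>X\<close> and \<^term>\<open>y\<close> the \<open>j\<close>-th vertex of \<^term>\<open>Y\<close>, then their labels differ by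
  \<open>card X + j - i\<close>. So it suffices to enumerate the two parts in such a way that \<open>i \<le> j\<close> for
  every edge.

  Such an enumeration is built greedily. Suppose that some \<^term>\<open>y \<in> Y\<close> has at most one neighbour
  in \<^term>\<open>X\<close>. Put \<^term>\<open>y\<close> first in \<^term>\<open>Y\<close>, put its neighbour (or any
  vertex, if it has none) first in \<^term>\<open>X\<close>, delete both and continue (\<open>sparse_bipartite_enumeration\<close>). The cardinalities both drop by one, so \<^term>\<open>X\<close>
  never becomes the larger part.

  The required \<^term>\<open>y\<close> exists because the graph has no cycle. Suppose instead that every vertex of
  \<^term>\<open>Y\<close> has two neighbours in \<^term>\<open>X\<close>. While some vertex of \<^term>\<open>X\<close> has at most one neighbour
  in \<^term>\<open>Y\<close>, delete it together with that neighbour: this preserves both the degree condition on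
  \<^term>\<open>Y\<close> and \<open>card X \<le> card Y\<close>. The process ends in a nonempty subgraph of minimum degree two
  (\<open>bipartite_min_degree_two_core\<close>), and the first vertex of a longest path in it closes a cycle
  (\<open>min_degree_two_imp_cycle\<close>).
\<close>

section \<open>Minimum degree two forces a cycle\<close>

text \<open>
  The first vertex \<^term>\<open>u\<close> of a longest path inside \<^term>\<open>S\<close> has all its neighbours in \<^term>\<open>S\<close> on
  the path. A neighbour other than the second vertex of the path closes a cycle that uses at least
  two edges of the path.
\<close>

lemma (in pair_graph) min_degree_two_imp_cycle:
  assumes "S \<subseteq> pverts G" "S \<noteq> {}"
    and deg: "\<And>u. u \<in> S \<Longrightarrow> \<exists>a\<in>S. \<exists>b\<in>S. a \<noteq> b \<and> (u, a) \<in> parcs G \<and> (u, b) \<in> parcs G"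
  shows "\<exists>p. cycle p \<and> 3 \<le> length p"
proof -
  define P where "P k \<longleftrightarrow> (\<exists>u p v. apath u p v \<and> set (awalk_verts u p) \<subseteq> S \<and> length p = k)" for k
  obtain s where "s \<in> S" using \<open>S \<noteq> {}\<close> by auto
  then have "apath s [] s" using \<open>S \<subseteq> pverts G\<close> by (auto simp: apath_Nil_iff)
  then have "P 0" using \<open>s \<in> S\<close> unfolding P_def by fastforce
  moreover have "\<forall>k. P k \<longrightarrow> k \<le> card S"
  proof (intro allI impI)
    fix k assume "P k"
    then obtain u p v where p: "apath u p v" "set (awalk_verts u p) \<subseteq> S" "length p = k"
      unfolding P_def by auto
    then have "Suc k = card (set (awalk_verts u p))"
      by (simp add: apath_def distinct_card length_awalk_verts)
    also have "\<dots> \<le> card S"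
      using p(2) \<open>S \<subseteq> pverts G\<close> pair_finite_verts by (meson card_mono finite_subset)
    finally show "k \<le> card S" by simp
  qed
  ultimately obtain k where "P k" and max: "\<And>j. P j \<Longrightarrow> j \<le> k"
    using GreatestI_nat[of P] Greatest_le_nat[of P] by metis
  then obtain u p v where p: "apath u p v" "set (awalk_verts u p) \<subseteq> S" "length p = k"
    unfolding P_def by auto
  have "u \<in> S" using p hd_in_awalk_verts by blast
  have on_path: "w \<in> set (awalk_verts u p)" if "w \<in> S" "(u, w) \<in> parcs G" for w
  proof (rule ccontr)
    assume "w \<notin> set (awalk_verts u p)"
    moreover have "(w, u) \<in> parcs G" using that(2) arcs_symmetric by auto
    ultimately have "apath w ((w, u) # p) v" using p(1) by (auto simp: apath_Cons_iff)
    moreover have "set (awalk_verts w ((w, u) # p)) \<subseteq> S" using p(2) that(1) by auto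
    ultimately have "P (Suc k)" unfolding P_def using p(3) by fastforce
    then show False using max by fastforce
  qed
  obtain w where w: "w \<in> S" "(u, w) \<in> parcs G" "\<not> (\<exists>es. p = (u, w) # es)"
    using deg[OF \<open>u \<in> S\<close>] by blast
  have "w \<noteq> u" using w(2) pair_no_loops by fastforce
  obtain q r where qr: "p = q @ r" "awalk u q w" "awalk w r v"
    using awalk_decomp[OF awalkI_apath[OF p(1)] on_path[OF w(1,2)]] by auto
  \<comment> \<open>Going along one edge and back would give a closed walk of length two.\<close>
  have "2 \<le> length q"
  proof (rule ccontr)
    assume "\<not> 2 \<le> length q"
    then consider "q = []" | e where "q = [e]" by (cases q) (auto simp: Suc_le_eq)
    then show False
      using qr \<open>w \<noteq> u\<close> w(3) by cases (auto simp: awalk_def)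
  qed
  moreover have "awalk w ((w, u) # q) w"
    using qr(2) w(2) arcs_symmetric by (auto simp: awalk_Cons_iff)
  moreover have "distinct (awalk_verts u q)"
    using p(1) qr awalk_verts_append[of u q r v] by (auto simp: apath_def)
  ultimately show ?thesis
    unfolding cycle_def by (intro exI[of _ "(w, u) # q"]) auto
qed

section \<open>Enumerating a sparse bipartite graph\<close>

text \<open>
  A vertex of \<^term>\<open>X\<close> with at most one neighbour in \<^term>\<open>Y\<close> can be deleted together with this
  neighbour (any vertex of \<^term>\<open>Y\<close> if there is none) without lowering the degree of the remaining
  vertices of \<^term>\<open>Y\<close>. The second part never runs empty: as long as it has a vertex, this vertex
  has two neighbours, so both parts have at least two vertices.
\<close>

lemma bipartite_min_degree_two_core:
  fixes E :: "'a \<Rightarrow> 'b \<Rightarrow> bool"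
  assumes "finite X" "finite Y" "card X \<le> card Y" "Y \<noteq> {}"
    and "\<forall>y\<in>Y. \<exists>a\<in>X. \<exists>b\<in>X. a \<noteq> b \<and> E a y \<and> E b y"
  shows "\<exists>X' Y'. X' \<subseteq> X \<and> Y' \<subseteq> Y \<and> Y' \<noteq> {}
    \<and> (\<forall>y\<in>Y'. \<exists>a\<in>X'. \<exists>b\<in>X'. a \<noteq> b \<and> E a y \<and> E b y)
    \<and> (\<forall>x\<in>X'. \<exists>a\<in>Y'. \<exists>b\<in>Y'. a \<noteq> b \<and> E x a \<and> E x b)"
  using assms
proof (induction "card X" arbitrary: X Y rule: less_induct)
  case less
  show ?case
  proof (cases "\<forall>x\<in>X. \<exists>a\<in>Y. \<exists>b\<in>Y. a \<noteq> b \<and> E x a \<and> E x b")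
    case True
    then show ?thesis
      by (intro exI[of _ X] exI[of _ Y] conjI subset_refl less.prems)
  next
    case False
    then obtain x where x: "x \<in> X" "\<And>a b. a \<in> Y \<Longrightarrow> b \<in> Y \<Longrightarrow> E x a \<Longrightarrow> E x b \<Longrightarrow> a = b" by blast
    obtain y where y: "y \<in> Y" "\<And>a. a \<in> Y \<Longrightarrow> E x a \<Longrightarrow> a = y"
      using x(2) \<open>Y \<noteq> {}\<close> by blast
    obtain a b where ab: "a \<in> X" "b \<in> X" "a \<noteq> b" using less.prems(5) y(1) by blast
    then have "2 \<le> card X"
      using card_mono[of X "{a, b}"] less.prems(1) by auto
    then have "2 \<le> card Y" using less.prems(3) by simp
    then have rest: "Y - {y} \<noteq> {}"
      using card_mono[of "{y}" Y] by auto
    have card: "card (X - {x}) < card X" "card (X - {x}) \<le> card (Y - {y})"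
      using x(1) y(1) less.prems(1-3) card_Diff1_less[of X x] by (simp_all add: diff_le_mono)
    have deg: "\<forall>z\<in>Y - {y}. \<exists>a\<in>X - {x}. \<exists>b\<in>X - {x}. a \<noteq> b \<and> E a z \<and> E b z"
      using less.prems(5) y(2) by blast
    obtain X' Y' where "X' \<subseteq> X - {x}" "Y' \<subseteq> Y - {y}" and core: "Y' \<noteq> {}"
      "\<forall>y\<in>Y'. \<exists>a\<in>X'. \<exists>b\<in>X'. a \<noteq> b \<and> E a y \<and> E b y"
      "\<forall>x\<in>X'. \<exists>a\<in>Y'. \<exists>b\<in>Y'. a \<noteq> b \<and> E x a \<and> E x b"
      using less.hyps[OF card(1) finite_Diff[OF less.prems(1)] finite_Diff[OF less.prems(2)]
          card(2) rest deg]
      by (elim exE conjE)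
    then have "X' \<subseteq> X" "Y' \<subseteq> Y" by auto
    then show ?thesis
      by (intro exI[of _ X'] exI[of _ Y'] conjI core)
  qed
qed

text \<open>
  A vertex of \<^term>\<open>Y\<close> with at most one neighbour may come first in \<^term>\<open>Y\<close> as soon as this
  neighbour comes first in \<^term>\<open>X\<close>. After both are deleted, all indices in the rest shift by one,
  which keeps the inequality. The sparsity hypothesis is stated for all subsets so that it survives
  the deletion.
\<close>

lemma sparse_bipartite_enumeration:
  fixes E :: "'a \<Rightarrow> 'b \<Rightarrow> bool"
  assumes "finite X" "finite Y" "card X \<le> card Y"
    and "\<And>X' Y'. X' \<subseteq> X \<Longrightarrow> Y' \<subseteq> Y \<Longrightarrow> card X' \<le> card Y' \<Longrightarrow> Y' \<noteq> {} \<Longrightarrow>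
      \<exists>y\<in>Y'. \<forall>a\<in>X'. \<forall>b\<in>X'. E a y \<longrightarrow> E b y \<longrightarrow> a = b"
  shows "\<exists>f g. bij_betw f X {1..card X} \<and> bij_betw g Y {1..card Y}
    \<and> (\<forall>x\<in>X. \<forall>y\<in>Y. E x y \<longrightarrow> f x \<le> g y)"
  using assms
proof (induction "card X" arbitrary: X Y)
  case 0
  then have "X = {}" by simp
  moreover obtain g where "bij_betw g Y {1..card Y}"
    using ex_bij_betw_finite_nat finite_same_card_bij[of Y "{1..card Y}"] \<open>finite Y\<close> by auto
  ultimately show ?case by (auto simp: bij_betw_def)
next
  case (Suc n)
  have "X \<noteq> {}" "Y \<noteq> {}" using Suc.hyps(2) Suc.prems(3) by auto
  obtain y where y: "y \<in> Y" "\<And>a b. a \<in> X \<Longrightarrow> b \<in> X \<Longrightarrow> E a y \<Longrightarrow> E b y \<Longrightarrow> a = b"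
    using Suc.prems(4)[of X Y] Suc.prems(3) \<open>Y \<noteq> {}\<close> by blast
  obtain x where x: "x \<in> X" "\<And>a. a \<in> X \<Longrightarrow> E a y \<Longrightarrow> a = x"
    using y(2) \<open>X \<noteq> {}\<close> by blast
  have cX: "card X = Suc (card (X - {x}))" and cY: "card Y = Suc (card (Y - {y}))"
    using x(1) y(1) Suc.prems(1,2) by (simp_all add: card_Suc_Diff1 del: card_Diff_insert)
  have "\<exists>f g. bij_betw f (X - {x}) {1..card (X - {x})} \<and> bij_betw g (Y - {y}) {1..card (Y - {y})}
    \<and> (\<forall>x'\<in>X - {x}. \<forall>y'\<in>Y - {y}. E x' y' \<longrightarrow> f x' \<le> g y')"
  proof (rule Suc.hyps(1))
    show "n = card (X - {x})" using Suc.hyps(2) cX by simp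
    show "card (X - {x}) \<le> card (Y - {y})" using Suc.prems(3) cX cY by simp
    show "\<exists>z\<in>Y'. \<forall>a\<in>X'. \<forall>b\<in>X'. E a z \<longrightarrow> E b z \<longrightarrow> a = b"
      if "X' \<subseteq> X - {x}" "Y' \<subseteq> Y - {y}" "card X' \<le> card Y'" "Y' \<noteq> {}" for X' Y'
      using Suc.prems(4)[of X' Y'] that by blast
  qed (use Suc.prems in auto)
  then obtain f g where
    fg: "bij_betw f (X - {x}) {1..card (X - {x})}" "bij_betw g (Y - {y}) {1..card (Y - {y})}"
    and le: "\<And>x' y'. x' \<in> X - {x} \<Longrightarrow> y' \<in> Y - {y} \<Longrightarrow> E x' y' \<Longrightarrow> f x' \<le> g y'" by blast
  have shift: "bij_betw (\<lambda>v. if v = z then 1 else Suc (h v)) Z {1..Suc (card (Z - {z}))}"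
    if "bij_betw h (Z - {z}) {1..card (Z - {z})}" "z \<in> Z" for h z and Z :: "'c set"
  proof -
    have "bij_betw (Suc \<circ> h) (Z - {z}) {2..Suc (card (Z - {z}))}"
      using that(1) by (rule bij_betw_trans)
        (auto simp: bij_betw_def numeral_2_eq_2)
    then have "bij_betw (\<lambda>v. if v = z then 1 else Suc (h v)) (Z - {z}) {2..Suc (card (Z - {z}))}"
      by (rule bij_betw_cong[THEN iffD1, rotated]) auto
    moreover have "bij_betw (\<lambda>v. if v = z then 1 else Suc (h v)) {z} {1}"
      by (auto simp: bij_betw_def)
    ultimately have "bij_betw (\<lambda>v. if v = z then 1 else Suc (h v)) ((Z - {z}) \<union> {z})
        ({2..Suc (card (Z - {z}))} \<union> {1})"
      by (rule bij_betw_combine) auto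
    moreover have "(Z - {z}) \<union> {z} = Z" using that(2) by auto
    moreover have "{2..Suc (card (Z - {z}))} \<union> {1} = {1..Suc (card (Z - {z}))}" by auto
    ultimately show ?thesis by simp
  qed
  define f' where "f' v = (if v = x then 1 else Suc (f v))" for v
  define g' where "g' v = (if v = y then 1 else Suc (g v))" for v
  have "bij_betw f' X {1..card X}" "bij_betw g' Y {1..card Y}"
    unfolding f'_def g'_def cX cY using shift fg x(1) y(1)
    by (auto simp del: card_Diff_insert)
  moreover have "\<forall>a\<in>X. \<forall>b\<in>Y. E a b \<longrightarrow> f' a \<le> g' b"
    using le x(2) by (auto simp: f'_def g'_def)
  ultimately show ?case by blast
qed

section \<open>Labelings of trees\<close>

text \<open>
  A violation of sparsity is a pair of subsets \<open>card X' \<le> card Y'\<close> in which every vertex of \<open>Y'\<close>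
  has two neighbours. It contains a subgraph of minimum degree two, and hence a cycle.
\<close>

lemma undirected_tree_enumeration:
  assumes "undirected_tree G" "bipartition G X Y" "card X \<le> card Y"
  shows "\<exists>f g. bij_betw f X {1..card X} \<and> bij_betw g Y {1..card Y}
    \<and> (\<forall>x\<in>X. \<forall>y\<in>Y. (x, y) \<in> parcs G \<longrightarrow> f x \<le> g y)"
proof -
  interpret pair_graph G using assms(1) by (simp add: undirected_tree_def)
  have acyclic: "\<not> (\<exists>p. cycle p \<and> 3 \<le> length p)"
    using assms(1) by (simp add: undirected_tree_def)
  have XY: "X \<union> Y = pverts G" using assms(2) by (simp add: bipartition_def)
  then have fin: "finite X" "finite Y" using pair_finite_verts by (metis finite_Un)+
  show ?thesis
  proof (rule sparse_bipartite_enumeration[OF fin assms(3)])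
    fix X' Y' assume sub: "X' \<subseteq> X" "Y' \<subseteq> Y" and card: "card X' \<le> card Y'" "Y' \<noteq> {}"
    show "\<exists>y\<in>Y'. \<forall>a\<in>X'. \<forall>b\<in>X'. (a, y) \<in> parcs G \<longrightarrow> (b, y) \<in> parcs G \<longrightarrow> a = b"
    proof (rule ccontr)
      assume "\<not> ?thesis"
      then have deg: "\<forall>y\<in>Y'. \<exists>a\<in>X'. \<exists>b\<in>X'. a \<noteq> b \<and> (a, y) \<in> parcs G \<and> (b, y) \<in> parcs G"
        by blast
      have "finite X'" "finite Y'" using sub fin finite_subset by blast+
      from bipartite_min_degree_two_core[where E = "\<lambda>u v. (u, v) \<in> parcs G", OF this card deg]
      obtain A B where AB: "A \<subseteq> X'" "B \<subseteq> Y'" "B \<noteq> {}"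
        and A: "\<forall>y\<in>B. \<exists>a\<in>A. \<exists>b\<in>A. a \<noteq> b \<and> (a, y) \<in> parcs G \<and> (b, y) \<in> parcs G"
        and B: "\<forall>x\<in>A. \<exists>a\<in>B. \<exists>b\<in>B. a \<noteq> b \<and> (x, a) \<in> parcs G \<and> (x, b) \<in> parcs G"
        by (elim exE conjE)
      have "\<exists>p. cycle p \<and> 3 \<le> length p"
      proof (rule min_degree_two_imp_cycle[of "A \<union> B"])
        show "A \<union> B \<subseteq> pverts G" using AB(1,2) sub XY by blast
        show "\<exists>a\<in>A \<union> B. \<exists>b\<in>A \<union> B. a \<noteq> b \<and> (u, a) \<in> parcs G \<and> (u, b) \<in> parcs G"
          if "u \<in> A \<union> B" for u
        proof (cases "u \<in> A")
          case True
          then show ?thesis using B by blast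
        next
          case False
          then have "u \<in> B" using that by blast
          then show ?thesis using A arcs_symmetric by blast
        qed
      qed (use AB(3) in auto)
      then show False using acyclic by blast
    qed
  qed
qed

text \<open>
  Shifting the enumeration of \<^term>\<open>Y\<close> by \<open>card X\<close> puts its labels directly above those of
  \<^term>\<open>X\<close>, and this shift is what bounds the weights from below.
\<close>

lemma undirected_tree_labeling:
  assumes "undirected_tree G" "bipartition G X Y" "card X \<le> card Y" "card (pverts G) = n"
  shows "\<exists>\<psi>\<in>no_hole_labelings n G. \<forall>e\<in>parcs G. card X \<le> edge_weight \<psi> e"
proof -
  interpret pair_graph G using assms(1) by (simp add: undirected_tree_def)
  have XY: "X \<union> Y = pverts G" "X \<inter> Y = {}"
    and arcs: "\<And>u v. (u, v) \<in> parcs G \<Longrightarrow> (u \<in> X \<and> v \<in> Y) \<or> (u \<in> Y \<and> v \<in> X)"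
    using assms(2) unfolding bipartition_def by blast+
  have fin: "finite X" "finite Y" using XY(1) pair_finite_verts by (metis finite_Un)+
  then have n: "n = card X + card Y" using assms(4) XY card_Un_disjoint by metis
  obtain f g where f: "bij_betw f X {1..card X}" and g: "bij_betw g Y {1..card Y}"
    and le: "\<And>x y. x \<in> X \<Longrightarrow> y \<in> Y \<Longrightarrow> (x, y) \<in> parcs G \<Longrightarrow> f x \<le> g y"
    using undirected_tree_enumeration[OF assms(1-3)] by blast
  \<comment> \<open>Labelings are extensional functions, hence undefined outside the vertex set.\<close>
  define \<psi> where
    "\<psi> = (\<lambda>v. if v \<in> X then f v else if v \<in> Y then card X + g v else undefined)"
  have X: "\<psi> x = f x" if "x \<in> X" for x using that by (simp add: \<psi>_def)
  have Y: "\<psi> y = card X + g y" if "y \<in> Y" for y using that XY(2) by (auto simp: \<psi>_def)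
  have "\<psi> ` X = {1..card X}"
    using f X by (simp add: bij_betw_def)
  moreover have "\<psi> ` Y = {card X + 1..card X + card Y}"
  proof -
    have "\<psi> ` Y = (+) (card X) ` (g ` Y)"
      unfolding image_image using Y by (rule image_cong[OF refl])
    then show ?thesis using g by (simp add: bij_betw_def)
  qed
  ultimately have "\<psi> ` pverts G = {1..n}"
    unfolding XY(1)[symmetric] image_Un n by auto
  moreover have "\<psi> \<in> extensional (pverts G)"
    using XY(1) by (auto simp: \<psi>_def extensional_def)
  ultimately have "\<psi> \<in> no_hole_labelings n G"
    by (auto simp: no_hole_labelings_def PiE_def)
  moreover have "card X \<le> edge_weight \<psi> (u, v)" if "(u, v) \<in> parcs G" for u v
  proof -
    \<comment> \<open>The weights are \<open>card X + g y - f x\<close> with \<open>f x \<le> g y\<close>.\<close>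
    have "(v, u) \<in> parcs G" using that arcs_symmetric by blast
    from arcs[OF that] show ?thesis
    proof (elim disjE conjE)
      assume "u \<in> X" "v \<in> Y"
      then show ?thesis using le[of u v] that by (simp add: edge_weight_def X Y)
    next
      assume "u \<in> Y" "v \<in> X"
      then show ?thesis using le[of v u] \<open>(v, u) \<in> parcs G\<close> by (simp add: edge_weight_def X Y)
    qed
  qed
  ultimately show ?thesis by (intro bexI[of _ \<psi>]) auto
qed

text \<open>
  The minimum over the edges says something about the labeling only if there is an edge; this is
  where connectedness enters.
\<close>

lemma connected_imp_arc:
  assumes "connected (with_proj G)" "u \<in> pverts G" "v \<in> pverts G" "u \<noteq> v"
  shows "parcs G \<noteq> {}"
proof
  assume empty: "parcs G = {}"
  have "u \<rightarrow>\<^sup>*\<^bsub>with_proj (mk_symmetric G)\<^esub> v"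
    using assms by (auto simp: connected_def strongly_connected_def)
  then show False
    using assms(4) empty unfolding reachable_def
    by (auto elim!: rtrancl_on.cases simp: parcs_mk_symmetric)
qed

lemma mc_nh_ge:
  assumes "finite (pverts G)" "finite (parcs G)" "parcs G \<noteq> {}"
    and "\<psi> \<in> no_hole_labelings n G" "\<forall>e\<in>parcs G. q \<le> edge_weight \<psi> e"
  shows "q \<le> mc_nh n G"
proof -
  have "finite (no_hole_labelings n G)"
    by (rule finite_subset[OF _ finite_PiE[OF assms(1), of "\<lambda>_. {1..n}"]])
      (auto simp: no_hole_labelings_def)
  then have "labeling_weight G \<psi> \<le> mc_nh n G"
    unfolding mc_nh_def using assms(4) by (intro Max_ge) auto
  moreover have "q \<le> labeling_weight G \<psi>"
    unfolding labeling_weight_def using assms(2,3,5) by (subst Min_ge_iff) auto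
  ultimately show ?thesis by simp
qed

theorem theorem12:
  fixes T :: "'a pair_pre_digraph" and X1 X2 :: "'a set" and n q1 q2 :: nat
  assumes "undirected_tree T" and "card (pverts T) = n"
    and "bipartition T X1 X2"
    and "card X1 = q1" and "card X2 = q2"
  shows "mc_nh n T \<ge> min q1 q2"
proof (cases "min q1 q2 = 0")
  case True
  then show ?thesis by simp
next
  case False
  interpret pair_graph T using assms(1) by (simp add: undirected_tree_def)
  have swap: "bipartition T X2 X1"
    using assms(3) by (auto simp: bipartition_def)
  have "X1 \<noteq> {}" "X2 \<noteq> {}" using False assms(4,5) by auto
  then obtain u v where "u \<in> X1" "v \<in> X2" by blast
  then have "u \<in> pverts T" "v \<in> pverts T" "u \<noteq> v"
    using assms(3) by (auto simp: bipartition_def)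
  then have "parcs T \<noteq> {}"
    using connected_imp_arc[of T u v] assms(1) unfolding undirected_tree_def by blast
  moreover obtain \<psi> where "\<psi> \<in> no_hole_labelings n T" "\<forall>e\<in>parcs T. min q1 q2 \<le> edge_weight \<psi> e"
  proof (cases "q1 \<le> q2")
    case True
    then show ?thesis
      using undirected_tree_labeling[OF assms(1,3) _ assms(2)] assms(4,5) that by auto
  next
    case False
    then show ?thesis
      using undirected_tree_labeling[OF assms(1) swap _ assms(2)] assms(4,5) that by auto
  qed
  ultimately show ?thesis
    using mc_nh_ge pair_finite_verts pair_finite_arcs by blast
qed

end
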